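(* Let $\Gamma$ be the $3$-regular tree and $\Gamma_0$ its edge graph, with graph distance $d$. Let $E_6\subset\ell^2(\Gamma_0)$ be the space of $F\in\ell^2(\Gamma_0)$ with $-\Delta_{\Gamma_0}F=6F$. Define $$\tilde P_6(x,y)=\tfrac13\left(-\tfrac12\right)^{d(x,y)},\qquad \tilde P_6F(x)=\sum_{y\in\Gamma_0}\tilde P_6(x,y)F(y).$$ Then $\tilde P_6$ is the orthogonal projection of $\ell^2(\Gamma_0)$ onto $E_6$.
   Context: The edge graph $\Gamma_0$ has the edges of $\Gamma$ as vertices, two being adjacent iff they share an endpoint (it is $4$-regular). $\Delta_{\Gamma_0}F(x)=\sum_{y\sim x}(F(y)-F(x))$. $\ell^2$ is with respect to counting measure on vertices. *)

theory Defs
  imports "HOL-Analysis.Infinite_Sum"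
begin

section \<open>Simple graphs, possibly infinite\<close>

record 'v sgraph =
  verts :: "'v set"
  edges :: "'v set set"

definition simple_graph :: "'v sgraph \<Rightarrow> bool" where
  "simple_graph G \<longleftrightarrow>
     (\<forall>e\<in>edges G. \<exists>u\<in>verts G. \<exists>v\<in>verts G. u \<noteq> v \<and> e = {u, v})"

definition neighbors :: "'v sgraph \<Rightarrow> 'v \<Rightarrow> 'v set" where
  "neighbors G x = {y \<in> verts G. {x, y} \<in> edges G}"

definition regular_graph :: "nat \<Rightarrow> 'v sgraph \<Rightarrow> bool" where
  "regular_graph k G \<longleftrightarrow>
     (\<forall>x\<in>verts G. finite (neighbors G x) \<and> card (neighbors G x) = k)"

text \<open>A walk is given by its list of vertices; the walk \<open>xs\<close> traverses \<open>length xs - 1\<close> edges.\<close>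

definition walk :: "'v sgraph \<Rightarrow> 'v list \<Rightarrow> bool" where
  "walk G xs \<longleftrightarrow> xs \<noteq> [] \<and> set xs \<subseteq> verts G \<and>
     (\<forall>i. Suc i < length xs \<longrightarrow> {xs ! i, xs ! Suc i} \<in> edges G)"

definition walk_betw :: "'v sgraph \<Rightarrow> 'v \<Rightarrow> nat \<Rightarrow> 'v \<Rightarrow> bool" where
  "walk_betw G x n y \<longleftrightarrow>
     (\<exists>xs. walk G xs \<and> hd xs = x \<and> last xs = y \<and> length xs = Suc n)"

definition connected_graph :: "'v sgraph \<Rightarrow> bool" where
  "connected_graph G \<longleftrightarrow> verts G \<noteq> {} \<and>
     (\<forall>x\<in>verts G. \<forall>y\<in>verts G. \<exists>n. walk_betw G x n y)"

text \<open>The list of a cycle does not repeat its first vertex at the end.\<close>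

definition cycle :: "'v sgraph \<Rightarrow> 'v list \<Rightarrow> bool" where
  "cycle G xs \<longleftrightarrow>
     walk G xs \<and> distinct xs \<and> 3 \<le> length xs \<and> {last xs, hd xs} \<in> edges G"

definition tree_graph :: "'v sgraph \<Rightarrow> bool" where
  "tree_graph G \<longleftrightarrow> simple_graph G \<and> connected_graph G \<and> (\<nexists>xs. cycle G xs)"

text \<open>Only meaningful for \<open>x\<close>, \<open>y\<close> in the same connected component.\<close>

definition gdist :: "'v sgraph \<Rightarrow> 'v \<Rightarrow> 'v \<Rightarrow> nat" where
  "gdist G x y = (LEAST n. walk_betw G x n y)"

definition edge_graph :: "'v sgraph \<Rightarrow> 'v set sgraph" where
  "edge_graph G =
     \<lparr>verts = edges G,
      edges = {{e, f} | e f. e \<in> edges G \<and> f \<in> edges G \<and> e \<noteq> f \<and> e \<inter> f \<noteq> {}}\<rparr>"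

section \<open>Square-summable functions on a set\<close>

text \<open>
  Complex functions on \<open>V\<close> are represented by functions on the whole type that vanish off \<open>V\<close>,
  so that equality of functions is equality on \<open>V\<close>.
\<close>

definition l2 :: "'a set \<Rightarrow> ('a \<Rightarrow> complex) set" where
  "l2 V = {F. (\<forall>x. x \<notin> V \<longrightarrow> F x = 0) \<and> (\<lambda>x. (cmod (F x))\<^sup>2) summable_on V}"

definition l2_inner :: "'a set \<Rightarrow> ('a \<Rightarrow> complex) \<Rightarrow> ('a \<Rightarrow> complex) \<Rightarrow> complex" where
  "l2_inner V F H = (\<Sum>\<^sub>\<infinity>x\<in>V. F x * cnj (H x))"

text \<open>
  \<open>P F\<close> is the component in \<open>E\<close> of the decomposition \<open>F = P F + (F - P F)\<close> along \<open>E\<close> and its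
  orthogonal complement.  This forces \<open>E\<close> to be a closed subspace: any \<open>F\<close> in the closed span of
  \<open>E\<close> has \<open>F - P F\<close> both in that span and orthogonal to it, hence \<open>F = P F \<in> E\<close>.
\<close>

definition orthogonal_projection_onto ::
  "'a set \<Rightarrow> ('a \<Rightarrow> complex) set \<Rightarrow> (('a \<Rightarrow> complex) \<Rightarrow> ('a \<Rightarrow> complex)) \<Rightarrow> bool" where
  "orthogonal_projection_onto V E P \<longleftrightarrow> E \<subseteq> l2 V \<and>
     (\<forall>F\<in>l2 V. P F \<in> E \<and> (\<forall>H\<in>E. l2_inner V (\<lambda>x. F x - P F x) H = 0))"

section \<open>Laplacian, eigenspaces and the kernel operator\<close>

definition laplacian :: "'v sgraph \<Rightarrow> ('v \<Rightarrow> complex) \<Rightarrow> 'v \<Rightarrow> complex" where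
  "laplacian G F x = (\<Sum>y\<in>neighbors G x. F y - F x)"

definition eigenspace :: "'v sgraph \<Rightarrow> complex \<Rightarrow> ('v \<Rightarrow> complex) set" where
  "eigenspace G c = {F \<in> l2 (verts G). \<forall>x\<in>verts G. - laplacian G F x = c * F x}"

definition P6_kernel :: "'v sgraph \<Rightarrow> 'v \<Rightarrow> 'v \<Rightarrow> real" where
  "P6_kernel G x y = 1 / 3 * (- (1 / 2)) ^ gdist G x y"

definition P6 :: "'v sgraph \<Rightarrow> ('v \<Rightarrow> complex) \<Rightarrow> ('v \<Rightarrow> complex)" where
  "P6 G F x =
     (if x \<in> verts G then \<Sum>\<^sub>\<infinity>y\<in>verts G. complex_of_real (P6_kernel G x y) * F y else 0)"

end

theory Submission
  imports Defs
begin

text \<open>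
  Let \<open>K(x, y) = (1/3) (-1/2)^d(x, y)\<close>.  The proof identifies \<open>K\<close> as the reproducing kernel of
  the eigenspace: each row \<open>K(x, \<cdot>)\<close> belongs to \<open>E\<^sub>6\<close>, and \<open>\<langle>F, K(x, \<cdot>)\<rangle> = F(x)\<close> for
  all \<open>F \<in> E\<^sub>6\<close>.

  The eigenvalue equation becomes local at the vertices of the tree.  Each vertex spans a
  triangle of the edge graph, and \<open>-\<Delta>F = 6F\<close> at an edge says that the sums of \<open>F\<close> over
  the triangles at its two ends add up to zero.  All these sums thus have the same modulus, and as
  the tree is infinite, square-summability makes them vanish.  So \<open>E\<^sub>6\<close> consists of the
  square-summable functions with vanishing sum at every vertex
  (\<open>eigenspace_eq_vanishing_vertex_sums\<close>).

  Now fix a root edge \<open>x\<close>.  As there are no cycles, one edge at each vertex is strictly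
  closest to \<open>x\<close> and the other two are one step further away (\<open>edges_at_vertex\<close>), and each
  edge other than \<open>x\<close> is the closest one at exactly one of its ends (\<open>edge_joins_levels\<close>).
  The first fact gives \<open>K(x, \<cdot>)\<close> vanishing vertex sums, because \<open>1 - 1/2 - 1/2 = 0\<close>.  Both
  together show that a function whose values on the two far edges at a vertex always add up to \<open>c\<close>
  times its value on the near edge has sphere sums in geometric progression
  (\<open>sum_sphere_geometric\<close>).  With \<open>c = 1/2\<close> this yields that \<open>K(x, \<cdot>)\<close> is square-summable and,
  applied to \<open>K(x, \<cdot>) F\<close>, the reproducing property (\<open>kernel_reproducing\<close>).

  The rows of \<open>K\<close> are not absolutely summable: the sphere of radius \<open>n > 0\<close> has \<open>2 \<cdot> 2\<^sup>n\<close>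
  elements.  So the boundedness of the operator is obtained from the reproducing property and not from the
  size of the kernel.  A reproducing kernel always defines a contraction
  (\<open>reproducing_kernel_contraction\<close>); it fixes \<open>E\<^sub>6\<close>, and an idempotent of norm at most one is
  orthogonal (\<open>reproducing_kernel_orthogonal_projection\<close>).
\<close>

section \<open>Square-summable functions\<close>

lemma mult_cnj_norm: "z * cnj z = of_real ((cmod z)\<^sup>2)"
  by (rule complex_norm_square[symmetric])

abbreviation l2_normsq :: "'a set \<Rightarrow> ('a \<Rightarrow> complex) \<Rightarrow> real" where
  "l2_normsq V F \<equiv> (\<Sum>\<^sub>\<infinity>x\<in>V. (cmod (F x))\<^sup>2)"

lemma l2_vanishes: "F \<in> l2 V \<Longrightarrow> x \<notin> V \<Longrightarrow> F x = 0"
  by (auto simp: l2_def)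

lemma l2_square_summable: "F \<in> l2 V \<Longrightarrow> (\<lambda>x. (cmod (F x))\<^sup>2) summable_on V"
  by (auto simp: l2_def)

lemma l2_scale: "F \<in> l2 V \<Longrightarrow> (\<lambda>x. c * F x) \<in> l2 V"
  by (auto simp: l2_def norm_mult power_mult_distrib intro: summable_on_cmult_right)

lemma l2_add:
  assumes "F \<in> l2 V" "H \<in> l2 V"
  shows "(\<lambda>x. F x + H x) \<in> l2 V"
proof -
  have "(\<lambda>x. 2 * (cmod (F x))\<^sup>2 + 2 * (cmod (H x))\<^sup>2) summable_on V"
    using assms by (intro summable_on_add summable_on_cmult_right l2_square_summable)
  moreover have "(cmod (F x + H x))\<^sup>2 \<le> 2 * (cmod (F x))\<^sup>2 + 2 * (cmod (H x))\<^sup>2" for x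
  proof -
    have "(cmod (F x + H x))\<^sup>2 \<le> (cmod (F x) + cmod (H x))\<^sup>2"
      by (intro power_mono norm_triangle_ineq norm_ge_zero)
    also have "\<dots> \<le> 2 * (cmod (F x))\<^sup>2 + 2 * (cmod (H x))\<^sup>2"
      using sum_squares_bound[of "cmod (F x)" "cmod (H x)"] by (simp add: power2_sum)
    finally show ?thesis .
  qed
  ultimately have "(\<lambda>x. (cmod (F x + H x))\<^sup>2) summable_on V"
    by (rule summable_on_comparison_test) auto
  then show ?thesis
    using assms by (auto simp: l2_def)
qed

lemma l2_diff:
  assumes "F \<in> l2 V" "H \<in> l2 V"
  shows "(\<lambda>x. F x - H x) \<in> l2 V"
  using l2_add[OF assms(1) l2_scale[OF assms(2), of "-1"]] by simp

lemma l2_sum: "(\<And>i. i \<in> A \<Longrightarrow> f i \<in> l2 V) \<Longrightarrow> (\<lambda>x. \<Sum>i\<in>A. f i x) \<in> l2 V"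
proof (induction A rule: infinite_finite_induct)
  case (insert j A)
  then show ?case
    using l2_add[of "f j" V "\<lambda>x. \<Sum>i\<in>A. f i x"] by simp
qed (simp_all add: l2_def)

lemma l2_finite_support:
  assumes "finite A" "A \<subseteq> V"
  shows "(\<lambda>x. if x \<in> A then c x else 0) \<in> l2 V"
proof -
  have "(\<lambda>x. (cmod (if x \<in> A then c x else 0))\<^sup>2) summable_on V
      \<longleftrightarrow> (\<lambda>x. (cmod (c x))\<^sup>2) summable_on A"
    by (rule summable_on_cong_neutral) (use assms in auto)
  then show ?thesis
    using assms by (auto simp: l2_def)
qed

lemma l2_product_summable:
  assumes "F \<in> l2 V" "H \<in> l2 V"
  shows "(\<lambda>x. F x * cnj (H x)) summable_on V"
proof -
  have "(\<lambda>x. (cmod (F x))\<^sup>2 + (cmod (H x))\<^sup>2) summable_on V"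
    using assms by (intro summable_on_add l2_square_summable)
  moreover have "cmod (F x * cnj (H x)) \<le> (cmod (F x))\<^sup>2 + (cmod (H x))\<^sup>2" for x
  proof -
    have "2 * (cmod (F x) * cmod (H x)) \<le> (cmod (F x))\<^sup>2 + (cmod (H x))\<^sup>2"
      using sum_squares_bound[of "cmod (F x)" "cmod (H x)"] by simp
    moreover have "0 \<le> cmod (F x) * cmod (H x)"
      by simp
    ultimately show ?thesis
      unfolding norm_mult complex_mod_cnj by linarith
  qed
  ultimately have "(\<lambda>x. F x * cnj (H x)) abs_summable_on V"
    by (rule summable_on_comparison_test) auto
  then show ?thesis
    by (rule abs_summable_summable)
qed

lemma l2_inner_add:
  assumes "F \<in> l2 V" "F' \<in> l2 V" "H \<in> l2 V"
  shows "l2_inner V (\<lambda>x. F x + F' x) H = l2_inner V F H + l2_inner V F' H"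
  unfolding l2_inner_def distrib_right
  by (intro infsum_add l2_product_summable assms)

lemma l2_inner_scale: "l2_inner V (\<lambda>x. c * F x) H = c * l2_inner V F H"
  unfolding l2_inner_def by (simp add: mult.assoc infsum_cmult_right')

lemma l2_inner_diff:
  assumes "F \<in> l2 V" "F' \<in> l2 V" "H \<in> l2 V"
  shows "l2_inner V (\<lambda>x. F x - F' x) H = l2_inner V F H - l2_inner V F' H"
  using l2_inner_add[OF assms(1) l2_scale[OF assms(2), of "-1"] assms(3)]
        l2_inner_scale[of V "-1" F' H] by simp

lemma l2_inner_cnj: "l2_inner V H F = cnj (l2_inner V F H)"
  unfolding l2_inner_def infsum_cnj[symmetric] by (simp add: mult.commute)

lemma l2_inner_sum_right:
  assumes "F \<in> l2 V" "\<And>i. i \<in> A \<Longrightarrow> f i \<in> l2 V"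
  shows "l2_inner V F (\<lambda>x. \<Sum>i\<in>A. c i * f i x) = (\<Sum>i\<in>A. cnj (c i) * l2_inner V F (f i))"
proof -
  have "l2_inner V (\<lambda>x. \<Sum>i\<in>A. c i * f i x) F = (\<Sum>i\<in>A. c i * l2_inner V (f i) F)"
    using assms(2)
  proof (induction A rule: infinite_finite_induct)
    case (insert j A)
    then show ?case
      using assms(1)
      by (simp add: l2_inner_add l2_scale l2_sum l2_inner_scale)
  qed (auto simp: l2_inner_def)
  then show ?thesis
    by (subst l2_inner_cnj) (simp add: l2_inner_cnj[of V F])
qed

lemma l2_inner_finite_support:
  assumes "finite A" "A \<subseteq> V"
  shows "l2_inner V F (\<lambda>x. if x \<in> A then c x else 0) = (\<Sum>x\<in>A. F x * cnj (c x))"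
proof -
  have "l2_inner V F (\<lambda>x. if x \<in> A then c x else 0) = (\<Sum>\<^sub>\<infinity>x\<in>A. F x * cnj (c x))"
    unfolding l2_inner_def by (rule infsum_cong_neutral) (use assms in auto)
  then show ?thesis
    using assms by simp
qed

lemma l2_inner_self: "F \<in> l2 V \<Longrightarrow> l2_inner V F F = of_real (l2_normsq V F)"
proof -
  assume "F \<in> l2 V"
  have "l2_inner V F F = (\<Sum>\<^sub>\<infinity>x\<in>V. of_real ((cmod (F x))\<^sup>2))"
    unfolding l2_inner_def by (intro infsum_cong) (simp add: mult_cnj_norm)
  then show ?thesis
    by (simp only: infsumI[OF has_sum_of_real[OF has_sum_infsum[OF l2_square_summable]]] \<open>F \<in> l2 V\<close>)
qed

lemma l2_normsq_nonneg: "0 \<le> l2_normsq V F"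
  by (intro infsum_nonneg) auto

lemma l2_normsq_scale: "l2_normsq V (\<lambda>x. c * F x) = (cmod c)\<^sup>2 * l2_normsq V F"
  by (simp add: norm_mult power_mult_distrib infsum_cmult_right')

lemma l2_normsq_diff:
  assumes "F \<in> l2 V" "H \<in> l2 V"
  shows "l2_normsq V (\<lambda>x. F x - H x)
      = l2_normsq V F - 2 * Re (l2_inner V F H) + l2_normsq V H"
proof -
  have D: "(\<lambda>x. F x - H x) \<in> l2 V"
    by (intro l2_diff assms)
  have "of_real (l2_normsq V (\<lambda>x. F x - H x))
      = l2_inner V F (\<lambda>x. F x - H x) - l2_inner V H (\<lambda>x. F x - H x)"
    using l2_inner_diff[OF assms D] l2_inner_self[OF D] by simp
  also have "l2_inner V F (\<lambda>x. F x - H x) = cnj (l2_inner V F F - l2_inner V H F)"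
    by (subst l2_inner_cnj) (simp add: l2_inner_diff assms)
  also have "l2_inner V H (\<lambda>x. F x - H x) = cnj (l2_inner V F H - l2_inner V H H)"
    by (subst l2_inner_cnj) (simp add: l2_inner_diff assms)
  finally have "of_real (l2_normsq V (\<lambda>x. F x - H x))
      = of_real (l2_normsq V F) - l2_inner V F H - cnj (l2_inner V F H) + of_real (l2_normsq V H)"
    by (simp add: l2_inner_self assms l2_inner_cnj[of V H F])
  then have "Re (of_real (l2_normsq V (\<lambda>x. F x - H x)))
      = Re (of_real (l2_normsq V F) - l2_inner V F H - cnj (l2_inner V F H) + of_real (l2_normsq V H))"
    by (rule arg_cong)
  then show ?thesis
    by simp
qed

section \<open>Reproducing kernels and orthogonal projections\<close>

text \<open>
  Let \<open>s\<close> be the left-hand side and \<open>G\<close> the combination of the \<open>k x\<close>, \<open>x \<in> A\<close>, with coefficients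
  \<open>\<langle>F, k x\<rangle>\<close>.  Then \<open>\<langle>F, G\<rangle> = s\<close>, and \<open>\<parallel>G\<parallel>\<^sup>2\<close> is, by the reproducing property, the inner product of \<open>G\<close>
  with the finitely supported function \<open>C\<close> of the coefficients, where \<open>\<parallel>C\<parallel>\<^sup>2 = s\<close>.  So
  \<open>0 \<le> \<parallel>G - C\<parallel>\<^sup>2 = s - \<parallel>G\<parallel>\<^sup>2\<close> and \<open>0 \<le> \<parallel>F - G\<parallel>\<^sup>2 = \<parallel>F\<parallel>\<^sup>2 - 2 s + \<parallel>G\<parallel>\<^sup>2\<close>; adding the two gives the bound.
\<close>

lemma reproducing_kernel_bessel:
  assumes F: "F \<in> l2 V" and A: "finite A" "A \<subseteq> V"
    and K: "\<And>x. x \<in> V \<Longrightarrow> k x \<in> l2 V"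
    and rep: "\<And>x y. x \<in> V \<Longrightarrow> y \<in> V \<Longrightarrow> l2_inner V (k y) (k x) = k y x"
  shows "(\<Sum>x\<in>A. (cmod (l2_inner V F (k x)))\<^sup>2) \<le> l2_normsq V F"
proof -
  define c where "c x = l2_inner V F (k x)" for x
  define s where "s = (\<Sum>x\<in>A. (cmod (c x))\<^sup>2)"
  define G where "G = (\<lambda>y. \<Sum>x\<in>A. c x * k x y)"
  define C where "C = (\<lambda>x. if x \<in> A then c x else 0)"
  have kA: "k x \<in> l2 V" if "x \<in> A" for x
    using that A K by auto
  have G: "G \<in> l2 V"
    unfolding G_def by (intro l2_sum l2_scale kA)
  have C: "C \<in> l2 V"
    unfolding C_def by (intro l2_finite_support A)
  have FG: "l2_inner V F G = of_real s"
    unfolding G_def s_def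
    by (subst l2_inner_sum_right[OF F kA])
      (simp_all add: c_def[symmetric] mult_cnj_norm mult.commute)
  have Gk: "l2_inner V G (k y) = G y" if "y \<in> A" for y
  proof -
    have "l2_inner V (k y) G = (\<Sum>x\<in>A. cnj (c x) * l2_inner V (k y) (k x))"
      unfolding G_def using that by (intro l2_inner_sum_right kA)
    then have "l2_inner V G (k y) = (\<Sum>x\<in>A. c x * l2_inner V (k x) (k y))"
      by (subst l2_inner_cnj) (simp add: l2_inner_cnj[of V "k y"])
    also have "\<dots> = G y"
      unfolding G_def using that A by (intro sum.cong refl) (simp add: rep subset_iff)
    finally show ?thesis .
  qed
  have GC: "l2_inner V G C = of_real (l2_normsq V G)"
  proof -
    have "l2_inner V G G = (\<Sum>x\<in>A. cnj (c x) * G x)"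
      by (subst (2) G_def, subst l2_inner_sum_right[OF G kA]) (auto simp: Gk)
    also have "\<dots> = l2_inner V G C"
      unfolding C_def by (simp add: l2_inner_finite_support A mult.commute)
    finally show ?thesis
      by (simp add: l2_inner_self G)
  qed
  have nC: "l2_normsq V C = s"
  proof -
    have "of_real (l2_normsq V C) = l2_inner V C C"
      by (simp add: l2_inner_self C)
    also have "\<dots> = (\<Sum>x\<in>A. C x * cnj (c x))"
      by (subst (2) C_def) (simp add: l2_inner_finite_support A)
    also have "\<dots> = of_real s"
      unfolding C_def s_def by (simp add: mult_cnj_norm)
    finally show ?thesis
      using of_real_eq_iff by blast
  qed
  have "0 \<le> l2_normsq V (\<lambda>x. G x - C x)" "0 \<le> l2_normsq V (\<lambda>x. F x - G x)"
    by (rule l2_normsq_nonneg)+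
  then show ?thesis
    unfolding l2_normsq_diff[OF G C] l2_normsq_diff[OF F G] GC FG nC
    by (simp add: s_def c_def)
qed

text \<open>
  Since the bound is uniform in the finite set \<open>A\<close>, the function \<open>x \<mapsto> \<langle>F, k x\<rangle>\<close> is
  square-summable even if the rows of the kernel are not absolutely summable.
\<close>

lemma reproducing_kernel_contraction:
  assumes F: "F \<in> l2 V"
    and K: "\<And>x. x \<in> V \<Longrightarrow> k x \<in> l2 V"
    and rep: "\<And>x y. x \<in> V \<Longrightarrow> y \<in> V \<Longrightarrow> l2_inner V (k y) (k x) = k y x"
    and P: "\<And>x. x \<in> V \<Longrightarrow> PF x = l2_inner V F (k x)" "\<And>x. x \<notin> V \<Longrightarrow> PF x = 0"
  shows "PF \<in> l2 V" and "l2_normsq V PF \<le> l2_normsq V F"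
proof -
  have b: "(\<Sum>x\<in>A. (cmod (PF x))\<^sup>2) \<le> l2_normsq V F" if "finite A" "A \<subseteq> V" for A
    using reproducing_kernel_bessel[OF F that K rep] P(1) that(2)
    by (simp add: subset_iff cong: sum.cong)
  have s: "(\<lambda>x. (cmod (PF x))\<^sup>2) summable_on V"
    by (rule nonneg_bounded_partial_sums_imp_summable_on[where C = "l2_normsq V F"])
      (auto intro: b)
  then show "PF \<in> l2 V"
    using P(2) by (auto simp: l2_def)
  show "l2_normsq V PF \<le> l2_normsq V F"
    by (rule infsum_le_finite_sums[OF s]) (use b in auto)
qed

text \<open>
  \<open>P\<close> is linear, does not increase the norm, and fixes \<open>E\<close> pointwise, so it is an idempotent of
  norm at most one; such an idempotent is orthogonal.  Indeed \<open>P\<close> kills \<open>u = F - P F\<close>, hence for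
  \<open>H \<in> E\<close> and every scalar \<open>z\<close> the contraction property gives
  \<open>\<parallel>z H\<parallel>\<^sup>2 = \<parallel>P (u - z H)\<parallel>\<^sup>2 \<le> \<parallel>u - z H\<parallel>\<^sup>2\<close>, that is \<open>2 Re \<langle>u, z H\<rangle> \<le> \<parallel>u\<parallel>\<^sup>2\<close>.  The left-hand side is
  unbounded in \<open>z\<close> unless \<open>\<langle>u, H\<rangle> = 0\<close>.
\<close>

lemma reproducing_kernel_orthogonal_projection:
  assumes E: "E \<subseteq> l2 V"
    and K: "\<And>x. x \<in> V \<Longrightarrow> k x \<in> E"
    and rep: "\<And>F x. F \<in> E \<Longrightarrow> x \<in> V \<Longrightarrow> l2_inner V F (k x) = F x"
    and P: "\<And>F x. x \<in> V \<Longrightarrow> P F x = l2_inner V F (k x)" "\<And>F x. x \<notin> V \<Longrightarrow> P F x = 0"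
    and PE: "\<And>F. F \<in> l2 V \<Longrightarrow> P F \<in> l2 V \<Longrightarrow> P F \<in> E"
  shows "orthogonal_projection_onto V E P"
proof -
  have k: "k x \<in> l2 V" if "x \<in> V" for x
    using K[OF that] E by blast
  have kk: "l2_inner V (k y) (k x) = k y x" if "x \<in> V" "y \<in> V" for x y
    using rep K that by blast
  note contr = reproducing_kernel_contraction[OF _ k kk P]
  have PFE: "P F \<in> E" if "F \<in> l2 V" for F
    using PE contr(1) that by blast
  have "l2_inner V (\<lambda>x. F x - P F x) H = 0" if F: "F \<in> l2 V" and H: "H \<in> E" for F H
  proof (rule ccontr)
    define u where "u = (\<lambda>x. F x - P F x)"
    define w where "w = l2_inner V u H"
    assume "l2_inner V (\<lambda>x. F x - P F x) H \<noteq> 0"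
    then have w0: "(cmod w)\<^sup>2 > 0"
      by (simp add: w_def u_def)
    have H2: "H \<in> l2 V" and PF2: "P F \<in> l2 V"
      using H E PFE[OF F] by auto
    have u: "u \<in> l2 V"
      unfolding u_def by (intro l2_diff F PF2)
    have bound: "2 * t * (cmod w)\<^sup>2 \<le> l2_normsq V u" for t :: real
    proof -
      \<comment> \<open>This phase of \<open>z\<close> makes \<open>\<langle>u, z H\<rangle>\<close> equal to the real number \<open>t |w|\<^sup>2\<close>.\<close>
      define z where "z = of_real t * w"
      have zH: "(\<lambda>x. z * H x) \<in> l2 V"
        by (intro l2_scale H2)
      have "P (\<lambda>x. u x - z * H x) = (\<lambda>x. (- z) * H x)"
      proof
        fix x
        show "P (\<lambda>x. u x - z * H x) x = (- z) * H x"
        proof (cases "x \<in> V")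
          case True
          have "P (\<lambda>x. u x - z * H x) x = l2_inner V u (k x) - z * l2_inner V H (k x)"
            using True by (simp add: P l2_inner_diff[OF u zH k[OF True]] l2_inner_scale)
          also have "l2_inner V u (k x) = 0"
            unfolding u_def
            using True by (simp add: l2_inner_diff[OF F PF2 k[OF True]] rep PFE F P(1)[symmetric])
          finally show ?thesis
            using True H by (simp add: rep)
        next
          case False
          then show ?thesis
            using l2_vanishes[OF H2] by (simp add: P)
        qed
      qed
      then have "l2_normsq V (\<lambda>x. (- z) * H x) \<le> l2_normsq V (\<lambda>x. u x - z * H x)"
        using contr(2)[OF l2_diff[OF u zH]] by simp
      moreover have "l2_inner V u (\<lambda>x. z * H x) = of_real (t * (cmod w)\<^sup>2)"
        by (subst l2_inner_cnj, subst l2_inner_scale)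
          (simp add: l2_inner_cnj[of V H u] w_def[symmetric] z_def mult_cnj_norm mult_ac)
      ultimately show ?thesis
        unfolding l2_normsq_diff[OF u zH] l2_normsq_scale by simp
    qed
    have "2 * l2_normsq V u + 2 * (cmod w)\<^sup>2 \<le> l2_normsq V u"
      using bound[of "l2_normsq V u / (cmod w)\<^sup>2 + 1"] w0 by (simp add: distrib_right)
    then show False
      using w0 l2_normsq_nonneg[of u V] by linarith
  qed
  then show ?thesis
    unfolding orthogonal_projection_onto_def using E PFE by blast
qed

section \<open>Walks and distances\<close>

lemma walk_snoc:
  assumes "xs \<noteq> []"
  shows "walk G (xs @ [y]) \<longleftrightarrow> walk G xs \<and> y \<in> verts G \<and> {last xs, y} \<in> edges G"
proof -
  have "(\<forall>i. Suc i < length (xs @ [y]) \<longrightarrow> {(xs @ [y]) ! i, (xs @ [y]) ! Suc i} \<in> edges G)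
     \<longleftrightarrow> (\<forall>i. Suc i < length xs \<longrightarrow> {xs ! i, xs ! Suc i} \<in> edges G) \<and> {last xs, y} \<in> edges G"
    (is "?L \<longleftrightarrow> ?R")
  proof
    assume L: ?L
    have "{xs ! i, xs ! Suc i} \<in> edges G" if "Suc i < length xs" for i
      using L[rule_format, of i] that by (simp add: nth_append)
    moreover have "{last xs, y} \<in> edges G"
      using L[rule_format, of "length xs - 1"] assms
      by (simp add: nth_append last_conv_nth)
    ultimately show ?R by blast
  next
    assume R: ?R
    show ?L
    proof (intro allI impI)
      fix i assume i: "Suc i < length (xs @ [y])"
      show "{(xs @ [y]) ! i, (xs @ [y]) ! Suc i} \<in> edges G"
      proof (cases "Suc i < length xs")
        case True
        then show ?thesis using R by (simp add: nth_append)
      next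
        case False
        then have "i = length xs - 1"
          using i by simp
        then show ?thesis
          using R assms by (simp add: nth_append last_conv_nth)
      qed
    qed
  qed
  then show ?thesis
    using assms unfolding walk_def by auto
qed

lemma walk_join: "walk G (xs @ y # ys) \<longleftrightarrow> walk G (xs @ [y]) \<and> walk G (y # ys)"
proof (induction ys rule: rev_induct)
  case Nil
  then show ?case
    by (auto simp: walk_def)
next
  case (snoc z ys)
  have "walk G ((xs @ y # ys) @ [z]) \<longleftrightarrow> walk G (xs @ [y]) \<and> walk G ((y # ys) @ [z])"
    by (subst (1 2) walk_snoc) (auto simp: snoc.IH)
  then show ?case
    by simp
qed

lemma walk_Cons:
  assumes "xs \<noteq> []"
  shows "walk G (v # xs) \<longleftrightarrow> v \<in> verts G \<and> {v, hd xs} \<in> edges G \<and> walk G xs"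
proof -
  have "walk G (v # xs) \<longleftrightarrow> walk G ([v] @ [hd xs]) \<and> walk G xs"
    using walk_join[of G "[v]" "hd xs" "tl xs"] assms by simp
  also have "walk G ([v] @ [hd xs]) \<longleftrightarrow> walk G [v] \<and> hd xs \<in> verts G \<and> {v, hd xs} \<in> edges G"
    by (subst walk_snoc) simp_all
  also have "walk G [v] \<longleftrightarrow> v \<in> verts G"
    by (simp add: walk_def)
  finally show ?thesis
    using assms by (auto simp: walk_def)
qed

lemma walk_rev: "walk G (rev xs) \<longleftrightarrow> walk G xs"
proof (induction xs)
  case (Cons x xs)
  show ?case
  proof (cases "xs = []")
    case False
    then show ?thesis
      using Cons by (simp add: walk_snoc walk_Cons last_rev insert_commute) blast
  qed simp
qed simp

lemma walk_betw_0: "walk_betw G x 0 y \<longleftrightarrow> x = y \<and> x \<in> verts G"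
proof
  assume "x = y \<and> x \<in> verts G"
  then show "walk_betw G x 0 y"
    unfolding walk_betw_def walk_def by (intro exI[of _ "[x]"]) auto
qed (auto simp: walk_betw_def walk_def length_Suc_conv)

lemma walk_betw_Suc:
  "walk_betw G x (Suc n) y \<longleftrightarrow> (\<exists>z. walk_betw G x n z \<and> y \<in> verts G \<and> {z, y} \<in> edges G)"
proof
  assume "walk_betw G x (Suc n) y"
  then obtain xs where xs: "walk G xs" "hd xs = x" "last xs = y" "length xs = Suc (Suc n)"
    by (auto simp: walk_betw_def)
  then obtain ys where ys: "xs = ys @ [y]"
    by (metis append_butlast_last_id list.size(3) nat.distinct(1))
  then have "ys \<noteq> []" "length ys = Suc n"
    using xs by auto
  then have "walk_betw G x n (last ys)" "y \<in> verts G" "{last ys, y} \<in> edges G"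
    using xs ys walk_snoc[of ys G y] by (auto simp: walk_betw_def)
  then show "\<exists>z. walk_betw G x n z \<and> y \<in> verts G \<and> {z, y} \<in> edges G"
    by blast
next
  assume "\<exists>z. walk_betw G x n z \<and> y \<in> verts G \<and> {z, y} \<in> edges G"
  then obtain xs where "walk G xs" "hd xs = x" "length xs = Suc n" "y \<in> verts G"
      "{last xs, y} \<in> edges G"
    by (auto simp: walk_betw_def)
  moreover from this have "xs \<noteq> []"
    by auto
  ultimately show "walk_betw G x (Suc n) y"
    unfolding walk_betw_def by (intro exI[of _ "xs @ [y]"]) (simp add: walk_snoc)
qed

lemma walk_betw_sym: "walk_betw G x n y \<Longrightarrow> walk_betw G y n x"
proof -
  assume "walk_betw G x n y"
  then obtain xs where "walk G xs" "hd xs = x" "last xs = y" "length xs = Suc n"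
    by (auto simp: walk_betw_def)
  moreover from this have "xs \<noteq> []"
    by auto
  ultimately show "walk_betw G y n x"
    unfolding walk_betw_def by (intro exI[of _ "rev xs"]) (simp add: walk_rev hd_rev last_rev)
qed

lemma gdist_sym: "gdist G x y = gdist G y x"
  unfolding gdist_def by (rule arg_cong[where f = Least]) (auto intro: walk_betw_sym)

lemma walk_betw_gdist:
  assumes "connected_graph G" "x \<in> verts G" "y \<in> verts G"
  shows "walk_betw G x (gdist G x y) y"
proof -
  have "\<exists>n. walk_betw G x n y"
    using assms by (auto simp: connected_graph_def)
  then show ?thesis
    unfolding gdist_def by (rule LeastI_ex)
qed

lemma gdist_le: "walk_betw G x n y \<Longrightarrow> gdist G x y \<le> n"
  unfolding gdist_def by (rule Least_le)

lemma gdist_eq_0: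
  assumes "connected_graph G" "x \<in> verts G" "y \<in> verts G"
  shows "gdist G x y = 0 \<longleftrightarrow> x = y"
  using walk_betw_gdist[OF assms] gdist_le[of G x 0 y] assms(2) by (auto simp: walk_betw_0)

lemma gdist_step:
  assumes "connected_graph G" "x \<in> verts G" "y \<in> verts G" "z \<in> verts G" "{y, z} \<in> edges G"
  shows "gdist G x z \<le> Suc (gdist G x y)"
  using walk_betw_gdist[OF assms(1-3)] assms(4,5) by (intro gdist_le) (auto simp: walk_betw_Suc)

lemma gdist_predecessor:
  assumes "connected_graph G" "x \<in> verts G" "y \<in> verts G" "gdist G x y = Suc n"
  obtains z where "z \<in> verts G" "{z, y} \<in> edges G" "gdist G x z = n"
proof -
  obtain z where z: "walk_betw G x n z" "{z, y} \<in> edges G"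
    using walk_betw_gdist[OF assms(1-3)] assms(4) by (auto simp: walk_betw_Suc)
  from z(1) have zV: "z \<in> verts G"
    by (cases n) (auto simp: walk_betw_0 walk_betw_Suc)
  have "gdist G x z \<le> n"
    using z by (intro gdist_le)
  moreover have "Suc n \<le> Suc (gdist G x z)"
    using gdist_step[OF assms(1,2) zV assms(3) z(2)] assms(4) by simp
  ultimately show ?thesis
    using that zV z(2) by simp
qed

text \<open>
  A reflexive transitive closure is used in place of vertex lists, so that the paths found below
  can be reversed and concatenated without bookkeeping; only
  \<open>acyclic_neighbours_separated\<close> has to turn one of them into a list.
\<close>

definition connected_avoiding :: "'v sgraph \<Rightarrow> 'v \<Rightarrow> 'v \<Rightarrow> 'v \<Rightarrow> bool" where
  "connected_avoiding G v = (\<lambda>p q. {p, q} \<in> edges G \<and> p \<noteq> v \<and> q \<noteq> v)\<^sup>*\<^sup>*"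

lemma connected_avoiding_refl: "connected_avoiding G v p p"
  by (simp add: connected_avoiding_def)

lemma connected_avoiding_sym: "connected_avoiding G v p q \<Longrightarrow> connected_avoiding G v q p"
  unfolding connected_avoiding_def
proof (induction rule: rtranclp_induct)
  case (step r q)
  then show ?case
    by (intro converse_rtranclp_into_rtranclp[of _ q r]) (auto simp: insert_commute)
qed simp

lemma connected_avoiding_trans:
  "connected_avoiding G v p q \<Longrightarrow> connected_avoiding G v q r \<Longrightarrow> connected_avoiding G v p r"
  unfolding connected_avoiding_def by (rule rtranclp_trans)

lemma connected_avoiding_edge:
  "{p, q} \<in> edges G \<Longrightarrow> p \<noteq> v \<Longrightarrow> q \<noteq> v \<Longrightarrow> connected_avoiding G v p q"
  unfolding connected_avoiding_def by auto

lemma simple_graph_edge: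
  assumes "simple_graph G" "{p, q} \<in> edges G"
  shows "p \<in> verts G" "q \<in> verts G" "p \<noteq> q"
  using assms unfolding simple_graph_def by (metis doubleton_eq_iff)+

lemma connected_avoiding_walk:
  assumes "simple_graph G" "connected_avoiding G v p q" "p \<in> verts G" "p \<noteq> v"
  shows "\<exists>xs. walk G xs \<and> v \<notin> set xs \<and> hd xs = p \<and> last xs = q"
  using assms(2) unfolding connected_avoiding_def
proof (induction rule: rtranclp_induct)
  case base
  then show ?case
    using assms by (intro exI[of _ "[p]"]) (auto simp: walk_def)
next
  case (step q r)
  then obtain xs where xs: "walk G xs" "v \<notin> set xs" "hd xs = p" "last xs = q"
    by blast
  then have "xs \<noteq> []"
    by (auto simp: walk_def)
  then show ?case
    using xs step.hyps simple_graph_edge[OF assms(1), of q r]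
    by (intro exI[of _ "xs @ [r]"]) (auto simp: walk_snoc)
qed

lemma walk_shorten:
  assumes "walk G xs"
  shows "\<exists>ys. walk G ys \<and> distinct ys \<and> set ys \<subseteq> set xs \<and> hd ys = hd xs \<and> last ys = last xs"
  using assms
proof (induction "length xs" arbitrary: xs rule: less_induct)
  case less
  show ?case
  proof (cases "distinct xs")
    case False
    then obtain as y bs cs where xs: "xs = as @ [y] @ bs @ [y] @ cs"
      using not_distinct_decomp by blast
    then have "walk G (as @ [y])" "walk G (y # bs @ y # cs)"
      using less.prems walk_join[of G as y "bs @ y # cs"] by auto
    then have "walk G (as @ y # cs)"
      using walk_join[of G "y # bs" y cs] walk_join[of G as y cs] by auto
    then obtain ys where "walk G ys" "distinct ys" "set ys \<subseteq> set (as @ y # cs)"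
        "hd ys = hd (as @ y # cs)" "last ys = last (as @ y # cs)"
      using less.hyps[of "as @ y # cs"] xs by auto
    then show ?thesis
      unfolding xs by (intro exI[of _ ys]) (auto simp: hd_append)
  qed (use less.prems in blast)
qed

text \<open>
  A path from \<open>u\<close> to \<open>w\<close> that misses \<open>v\<close>, made free of repetitions, closes up to a cycle
  through \<open>v\<close>.  This is the only way in which the absence of cycles enters.
\<close>

lemma acyclic_neighbours_separated:
  assumes G: "tree_graph G" and e: "{v, u} \<in> edges G" "{v, w} \<in> edges G"
    and c: "connected_avoiding G v u w"
  shows "u = w"
proof (rule ccontr)
  assume uw: "u \<noteq> w"
  have s: "simple_graph G"
    using G by (simp add: tree_graph_def)
  obtain ys where ys: "walk G ys" "v \<notin> set ys" "hd ys = u" "last ys = w"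
    using connected_avoiding_walk[OF s c] simple_graph_edge[OF s e(1)] by auto
  obtain xs where xs: "walk G xs" "distinct xs" "v \<notin> set xs" "hd xs = u" "last xs = w"
    using walk_shorten[OF ys(1)] ys by blast
  have "xs \<noteq> []"
    using xs by (auto simp: walk_def)
  moreover from this have "2 \<le> length xs"
    using xs uw by (cases xs; cases "tl xs") auto
  ultimately have "cycle G (v # xs)"
    using xs e simple_graph_edge[OF s e(1)]
    by (auto simp: cycle_def walk_Cons insert_commute)
  then show False
    using G by (auto simp: tree_graph_def)
qed

section \<open>Levels of edges and vertices seen from a root edge\<close>

locale cubic_tree =
  fixes G :: "'v sgraph"
  assumes tree: "tree_graph G" and regular: "regular_graph 3 G"
begin

definition incident :: "'v \<Rightarrow> 'v set set" where
  "incident v = {e \<in> edges G. v \<in> e}"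

text \<open>
  From here on a root edge \<open>x\<close> is kept fixed while the distances \<open>d(x, e)\<close> to all edges \<open>e\<close>, the
  levels, are compared.  A vertex of \<open>G\<close> spans a triangle of the edge graph, and its level is
  the least one in this triangle.
\<close>

abbreviation level :: "'v set \<Rightarrow> 'v set \<Rightarrow> nat" where
  "level x e \<equiv> gdist (edge_graph G) x e"

definition vertex_level :: "'v set \<Rightarrow> 'v \<Rightarrow> nat" where
  "vertex_level x v = (LEAST n. \<exists>e\<in>incident v. level x e = n)"

lemma simple: "simple_graph G" and connected: "connected_graph G"
  using tree by (auto simp: tree_graph_def)

lemmas edge_ends = simple_graph_edge[OF simple]

lemma edgeE:
  assumes "e \<in> edges G"
  obtains u v where "e = {u, v}" "u \<noteq> v" "u \<in> verts G" "v \<in> verts G"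
proof -
  obtain u v where "u \<in> verts G" "v \<in> verts G" "u \<noteq> v" "e = {u, v}"
    using assms simple unfolding simple_graph_def by blast
  then show ?thesis
    using that by simp
qed

lemma edge_at:
  assumes "e \<in> edges G" "v \<in> e"
  obtains u where "e = {v, u}" "u \<noteq> v" "v \<in> verts G" "u \<in> verts G"
proof -
  obtain p q where "e = {p, q}" "p \<noteq> q" "p \<in> verts G" "q \<in> verts G"
    using assms(1) by (rule edgeE)
  then show ?thesis
    using that[of p] that[of q] assms(2) by (auto simp: insert_commute)
qed

lemma incidentD: "e \<in> incident v \<Longrightarrow> e \<in> edges G" "e \<in> incident v \<Longrightarrow> v \<in> e"
  by (auto simp: incident_def)

lemma incident_edgeE:
  assumes "e \<in> incident v"
  obtains u where "e = {v, u}" "u \<noteq> v" "v \<in> verts G" "u \<in> verts G"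
  using incidentD[OF assms] by (rule edge_at)

lemma incidentI: "e \<in> edges G \<Longrightarrow> v \<in> e \<Longrightarrow> e \<in> incident v"
  by (auto simp: incident_def)

lemma card_incident:
  assumes "v \<in> verts G"
  shows "finite (incident v)" "card (incident v) = 3"
proof -
  have "incident v = (\<lambda>w. {v, w}) ` neighbors G v"
  proof
    show "incident v \<subseteq> (\<lambda>w. {v, w}) ` neighbors G v"
    proof
      fix e assume e: "e \<in> incident v"
      then obtain u where "e = {v, u}" "u \<in> verts G"
        by (rule incident_edgeE)
      then show "e \<in> (\<lambda>w. {v, w}) ` neighbors G v"
        using incidentD(1)[OF e] by (auto simp: neighbors_def)
    qed
  qed (auto simp: incident_def neighbors_def)
  moreover have "inj_on (\<lambda>w. {v, w}) (neighbors G v)"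
    by (auto simp: inj_on_def doubleton_eq_iff)
  moreover have "finite (neighbors G v)" "card (neighbors G v) = 3"
    using regular assms by (auto simp: regular_graph_def)
  ultimately show "finite (incident v)" "card (incident v) = 3"
    by (auto simp: card_image)
qed

lemma verts_edge_graph [simp]: "verts (edge_graph G) = edges G"
  by (simp add: edge_graph_def)

lemma adjacent_edges_iff:
  "{e, f} \<in> edges (edge_graph G) \<longleftrightarrow> e \<in> edges G \<and> f \<in> edges G \<and> e \<noteq> f \<and> e \<inter> f \<noteq> {}"
proof
  assume "{e, f} \<in> edges (edge_graph G)"
  then obtain e' f' where "{e, f} = {e', f'}" "e' \<in> edges G" "f' \<in> edges G" "e' \<noteq> f'"
      "e' \<inter> f' \<noteq> {}"
    unfolding edge_graph_def by auto
  then show "e \<in> edges G \<and> f \<in> edges G \<and> e \<noteq> f \<and> e \<inter> f \<noteq> {}"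
    unfolding doubleton_eq_iff by (elim disjE conjE) (simp_all add: Int_commute)
next
  assume "e \<in> edges G \<and> f \<in> edges G \<and> e \<noteq> f \<and> e \<inter> f \<noteq> {}"
  then show "{e, f} \<in> edges (edge_graph G)"
    unfolding edge_graph_def by simp blast
qed

lemma adjacent_edgesI:
  "e \<in> incident v \<Longrightarrow> f \<in> incident v \<Longrightarrow> e \<noteq> f \<Longrightarrow> {e, f} \<in> edges (edge_graph G)"
  unfolding adjacent_edges_iff incident_def by blast

text \<open>
  Walking in the tree from an end of \<open>e\<close> to an end of \<open>f\<close>, one passes through successive
  edges, any two consecutive ones of which are equal or adjacent.
\<close>

lemma connected_edge_graph: "connected_graph (edge_graph G)"
  unfolding connected_graph_def
proof (intro conjI ballI)
  obtain v where v: "v \<in> verts G"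
    using connected by (auto simp: connected_graph_def)
  then have "incident v \<noteq> {}"
    using card_incident by fastforce
  then show "verts (edge_graph G) \<noteq> {}"
    by (auto simp: incident_def)
next
  fix e f assume "e \<in> verts (edge_graph G)" "f \<in> verts (edge_graph G)"
  then have e: "e \<in> edges G" and f: "f \<in> edges G"
    by auto
  have extend: "\<exists>n. walk_betw (edge_graph G) e n h"
    if "walk_betw (edge_graph G) e n g" "g \<in> incident v" "h \<in> incident v" for n g h v
  proof (cases "g = h")
    case False
    then have "walk_betw (edge_graph G) e (Suc n) h"
      using that by (auto simp: walk_betw_Suc incident_def adjacent_edges_iff)
    then show ?thesis ..
  qed (use that in blast)
  obtain a where a: "a \<in> e" "a \<in> verts G"
    using edgeE[OF e] by blast
  obtain b where b: "b \<in> f" "b \<in> verts G"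
    using edgeE[OF f] by blast
  have reach: "\<exists>g\<in>incident w. \<exists>n. walk_betw (edge_graph G) e n g" if "walk_betw G a k w" for k w
    using that
  proof (induction k arbitrary: w)
    case 0
    then have "e \<in> incident w"
      using a e by (simp add: walk_betw_0 incident_def)
    moreover have "walk_betw (edge_graph G) e 0 e"
      using e by (simp add: walk_betw_0)
    ultimately show ?case
      by blast
  next
    case (Suc k)
    then obtain z where z: "walk_betw G a k z" "{z, w} \<in> edges G"
      by (auto simp: walk_betw_Suc)
    then obtain g n where "g \<in> incident z" "walk_betw (edge_graph G) e n g"
      using Suc.IH by blast
    moreover have "{z, w} \<in> incident z" "{z, w} \<in> incident w"
      using z by (auto simp: incident_def)
    ultimately show ?case
      using extend by blast
  qed
  obtain k where "walk_betw G a k b"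
    using connected a b by (auto simp: connected_graph_def)
  then obtain g n where "g \<in> incident b" "walk_betw (edge_graph G) e n g"
    using reach by blast
  then show "\<exists>n. walk_betw (edge_graph G) e n f"
    using extend b f by (blast intro: incidentI)
qed

lemma level_eq_0: "x \<in> edges G \<Longrightarrow> e \<in> edges G \<Longrightarrow> level x e = 0 \<longleftrightarrow> e = x"
  using gdist_eq_0[OF connected_edge_graph, of x e] by auto

lemma level_self [simp]: "x \<in> edges G \<Longrightarrow> level x x = 0"
  by (simp add: level_eq_0)

lemma level_adjacent:
  assumes "x \<in> edges G" "e \<in> incident v" "f \<in> incident v"
  shows "level x f \<le> Suc (level x e)"
proof (cases "e = f")
  case False
  then show ?thesis
    using gdist_step[OF connected_edge_graph, of x e f] adjacent_edgesI[OF assms(2,3)] assms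
    by (auto simp: incident_def)
qed simp

lemma level_predecessor:
  assumes "x \<in> edges G" "e \<in> edges G" "level x e = Suc n"
  obtains f v where "e \<in> incident v" "f \<in> incident v" "level x f = n"
proof -
  obtain f where "{f, e} \<in> edges (edge_graph G)" "level x f = n"
    using gdist_predecessor[OF connected_edge_graph, of x e n] assms by auto
  then show ?thesis
    using that by (auto simp: adjacent_edges_iff incident_def)
qed

lemma vertex_level_le: "e \<in> incident v \<Longrightarrow> vertex_level x v \<le> level x e"
  unfolding vertex_level_def by (rule Least_le) blast

lemma vertex_level_attained:
  assumes "v \<in> verts G"
  obtains e where "e \<in> incident v" "level x e = vertex_level x v"
proof -
  have "incident v \<noteq> {}"
    using card_incident[OF assms] by fastforce
  then have "\<exists>n. \<exists>e\<in>incident v. level x e = n"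
    by blast
  then have "\<exists>e\<in>incident v. level x e = vertex_level x v"
    unfolding vertex_level_def by (rule LeastI_ex)
  then show ?thesis
    using that by blast
qed

lemma level_le_Suc_vertex_level:
  assumes "x \<in> edges G" "e \<in> incident v"
  shows "level x e \<le> Suc (vertex_level x v)"
proof -
  have "v \<in> verts G"
    using assms(2) by (rule incident_edgeE)
  then obtain f where "f \<in> incident v" "level x f = vertex_level x v"
    by (rule vertex_level_attained)
  then show ?thesis
    using level_adjacent[OF assms(1) _ assms(2), of f] by simp
qed

text \<open>
  Follow a shortest path of edges from \<open>e\<close> down to the root: all of them after \<open>e\<close> lie
  strictly below the level of \<open>v\<close> and so cannot contain \<open>v\<close>.
\<close>

lemma below_connected_to_root:
  assumes x: "x \<in> edges G" "a \<in> x"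
    and "e \<in> edges G" "v \<notin> e" "level x e \<le> vertex_level x v" "p \<in> e"
  shows "connected_avoiding G v p a"
  using assms(3-6)
proof (induction "level x e" arbitrary: e p)
  case 0
  then have "p \<in> x" "v \<notin> x"
    using level_eq_0[OF x(1), of e] by auto
  obtain q where q: "x = {p, q}"
    using edge_at[OF x(1) \<open>p \<in> x\<close>] by blast
  then have "a = p \<or> a = q"
    using x by blast
  then show ?case
    using x q \<open>v \<notin> x\<close> connected_avoiding_refl connected_avoiding_edge[of p q G v] by auto
next
  case (Suc n)
  obtain f q where f: "e \<in> incident q" "f \<in> incident q" "level x f = n"
    using level_predecessor[OF x(1) Suc.prems(1) Suc.hyps(2)[symmetric]] by blast
  have "v \<notin> f"
    using vertex_level_le[of f v x] f Suc.hyps(2) Suc.prems(3) incidentD(1)[OF f(2)]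
    by (auto intro: incidentI)
  then have "connected_avoiding G v q a"
    using Suc.hyps(1)[of f q] f Suc.hyps(2) Suc.prems(3) incidentD[OF f(2)] by auto
  moreover have "connected_avoiding G v p q"
  proof (cases "p = q")
    case False
    then have "e = {p, q}"
      using edge_at[OF Suc.prems(1) Suc.prems(4)] incidentD(2)[OF f(1)]
      by (metis insertE singletonD)
    then show ?thesis
      using Suc.prems by (auto intro: connected_avoiding_edge)
  qed (simp add: connected_avoiding_refl)
  ultimately show ?case
    using connected_avoiding_trans by metis
qed

lemma lowest_edge_leads_to_root:
  assumes x: "x \<in> edges G" "a \<in> x"
    and e: "{v, u} \<in> edges G" "level x {v, u} = vertex_level x v" "vertex_level x v \<noteq> 0"
  shows "connected_avoiding G v u a"
proof -
  obtain n where n: "level x {v, u} = Suc n"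
    using e(2,3) not0_implies_Suc by metis
  obtain f q where f: "{v, u} \<in> incident q" "f \<in> incident q" "level x f = n"
    using level_predecessor[OF x(1) e(1) n] by blast
  have "v \<notin> f"
    using vertex_level_le[of f v x] f n e(2) incidentD(1)[OF f(2)]
    by (auto intro: incidentI)
  moreover from this have "u \<in> f"
    using f by (auto simp: incident_def)
  ultimately show ?thesis
    using below_connected_to_root[OF x, of f v u] f n e(2) incidentD(1)[OF f(2)] by simp
qed

text \<open>
  The far ends of two lowest edges at \<open>v\<close> would both be connected to the root without using \<open>v\<close>,
  hence to each other.  At level 0 this argument is void, but there the only edge is the root.
\<close>

lemma lowest_edge_unique:
  assumes x: "x \<in> edges G"
    and e: "e \<in> incident v" "level x e = vertex_level x v"
    and f: "f \<in> incident v" "level x f = vertex_level x v"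
  shows "e = f"
proof (cases "vertex_level x v = 0")
  case True
  then show ?thesis
    using assms level_eq_0[OF x] by (auto simp: incident_def)
next
  case False
  obtain a where a: "a \<in> x"
    using edgeE[OF x] by blast
  obtain u where u: "e = {v, u}"
    using e(1) by (rule incident_edgeE)
  obtain w where w: "f = {v, w}"
    using f(1) by (rule incident_edgeE)
  have "connected_avoiding G v u a" "connected_avoiding G v w a"
    using lowest_edge_leads_to_root[OF x a, of v] u w e f False incidentD(1) by auto
  then have "connected_avoiding G v u w"
    using connected_avoiding_sym connected_avoiding_trans by metis
  then have "u = w"
    using acyclic_neighbours_separated[OF tree, of v u w] u w e f incidentD(1) by auto
  then show ?thesis
    using u w by simp
qed

text \<open>
  Otherwise both ends of the edge would have an edge leading down to the root; at \<open>u\<close>, the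
  neighbour \<open>v\<close> and the far end \<open>p\<close> of the descending edge would then be connected without
  using \<open>u\<close>.
\<close>

lemma no_horizontal_edge:
  assumes x: "x \<in> edges G" and e: "{u, v} \<in> edges G" "level x {u, v} = Suc n"
    and l: "vertex_level x u = n" "vertex_level x v = n"
  shows False
proof -
  obtain a where a: "a \<in> x"
    using edgeE[OF x] by blast
  obtain f where f: "f \<in> incident u" "level x f = n"
    using vertex_level_attained[of u x] edge_ends[OF e(1)] l by metis
  obtain g where g: "g \<in> incident v" "level x g = n"
    using vertex_level_attained[of v x] edge_ends[OF e(1)] l by metis
  have ug: "u \<notin> g"
  proof
    assume "u \<in> g"
    then have "g = {u, v}"
      using edge_at[of g u] incidentD[OF g(1)] edge_ends(3)[OF e(1)]
      by (metis insertE singletonD)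
    then show False
      using g e by simp
  qed
  obtain p where p: "f = {u, p}"
    using f(1) by (rule incident_edgeE)
  \<comment> \<open>At level 0 both \<open>f\<close> and \<open>g\<close> would be the root, which then would contain \<open>u\<close>.\<close>
  have "n \<noteq> 0"
    using f g ug level_eq_0[OF x, of f] level_eq_0[OF x, of g] by (auto simp: incident_def)
  then have "connected_avoiding G u p a"
    using lowest_edge_leads_to_root[OF x a, of u p] f p l incidentD(1) by auto
  moreover have "connected_avoiding G u v a"
    using below_connected_to_root[OF x a, of g u v] g ug l incidentD by auto
  ultimately have "connected_avoiding G u p v"
    using connected_avoiding_sym connected_avoiding_trans by metis
  then have "p = v"
    using acyclic_neighbours_separated[OF tree, of u p v] e f p incidentD(1) by auto
  then show False
    using f e p by simp
qed

lemma edge_joins_levels: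
  assumes x: "x \<in> edges G" and e: "e \<in> edges G" "level x e = Suc n"
  obtains u v where "e = {u, v}" "vertex_level x u = n" "vertex_level x v = Suc n"
proof -
  obtain f u where f: "e \<in> incident u" "f \<in> incident u" "level x f = n"
    using level_predecessor[OF x e] by blast
  obtain v where v: "e = {u, v}"
    using f(1) by (rule incident_edgeE)
  have u: "vertex_level x u = n"
    using vertex_level_le[OF f(2), of x] level_le_Suc_vertex_level[OF x f(1)] f e by simp
  have "e \<in> incident v"
    using v e by (auto intro: incidentI)
  then have "vertex_level x v = n \<or> vertex_level x v = Suc n"
    using vertex_level_le[of e v x] level_le_Suc_vertex_level[OF x, of e v] e by auto
  then show ?thesis
    using no_horizontal_edge[OF x, of u v n] e u v that by auto
qed

section \<open>Summation over spheres\<close>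

lemma edge_vertex: "e \<in> edges G \<Longrightarrow> v \<in> e \<Longrightarrow> v \<in> verts G"
  by (rule edge_at)

lemma finite_edge: "e \<in> edges G \<Longrightarrow> finite e"
  by (rule edgeE) auto

text \<open>
  The shape of a triangle of the edge graph seen from the root: one edge is closest, and the
  remaining ones are exactly one step further away.
\<close>

lemma edges_at_vertex:
  assumes x: "x \<in> edges G" and v: "v \<in> verts G"
  obtains d where "d \<in> incident v" "level x d = vertex_level x v"
    "\<And>e. e \<in> incident v - {d} \<Longrightarrow> level x e = Suc (vertex_level x v)"
proof -
  obtain d where d: "d \<in> incident v" "level x d = vertex_level x v"
    using v by (rule vertex_level_attained)
  have "level x e = Suc (vertex_level x v)" if e: "e \<in> incident v - {d}" for e
  proof -
    have "level x e \<noteq> vertex_level x v"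
      using lowest_edge_unique[OF x, of e v d] e d by blast
    then show ?thesis
      using vertex_level_le[of e v x] level_le_Suc_vertex_level[OF x, of e v] e by simp
  qed
  then show ?thesis
    using that d by blast
qed

lemma vertex_level_eq_0:
  assumes x: "x \<in> edges G" and v: "v \<in> verts G"
  shows "vertex_level x v = 0 \<longleftrightarrow> v \<in> x"
proof
  assume "vertex_level x v = 0"
  then show "v \<in> x"
    using vertex_level_attained[OF v, of x] level_eq_0[OF x] incidentD by metis
next
  assume "v \<in> x"
  then show "vertex_level x v = 0"
    using vertex_level_le[OF incidentI[OF x], of v x] x by simp
qed

definition edge_sphere :: "'v set \<Rightarrow> nat \<Rightarrow> 'v set set" where
  "edge_sphere x n = {e \<in> edges G. level x e = n}"

definition vertex_sphere :: "'v set \<Rightarrow> nat \<Rightarrow> 'v set" where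
  "vertex_sphere x n = {v \<in> verts G. vertex_level x v = n}"

definition edge_ball :: "'v set \<Rightarrow> nat \<Rightarrow> 'v set set" where
  "edge_ball x n = {e \<in> edges G. level x e \<le> n}"

lemma edge_sphere_0: "x \<in> edges G \<Longrightarrow> edge_sphere x 0 = {x}"
  using level_eq_0 by (auto simp: edge_sphere_def)

lemma finite_spheres:
  assumes x: "x \<in> edges G"
  shows "finite (edge_sphere x n)" "finite (vertex_sphere x n)"
proof -
  have vs: "finite (vertex_sphere x n)" if "finite (edge_sphere x n)" for n
  proof (rule finite_subset)
    show "vertex_sphere x n \<subseteq> \<Union>(edge_sphere x n)"
    proof
      fix v assume v: "v \<in> vertex_sphere x n"
      then obtain e where "e \<in> incident v" "level x e = vertex_level x v"
        using vertex_level_attained[of v x] by (auto simp: vertex_sphere_def)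
      then show "v \<in> \<Union>(edge_sphere x n)"
        using v incidentD[of e v] by (auto simp: vertex_sphere_def edge_sphere_def)
    qed
    show "finite (\<Union>(edge_sphere x n))"
      using that finite_edge by (auto simp: edge_sphere_def)
  qed
  show s: "finite (edge_sphere x n)"
  proof (induction n)
    case 0
    then show ?case
      using x by (simp add: edge_sphere_0)
  next
    case (Suc n)
    show ?case
    proof (rule finite_subset)
      show "edge_sphere x (Suc n) \<subseteq> (\<Union>v\<in>vertex_sphere x n. incident v)"
      proof
        fix e assume "e \<in> edge_sphere x (Suc n)"
        then have e: "e \<in> edges G" "level x e = Suc n"
          by (auto simp: edge_sphere_def)
        then obtain u v where "e = {u, v}" "vertex_level x u = n"
          using edge_joins_levels[OF x e] by blast
        then show "e \<in> (\<Union>v\<in>vertex_sphere x n. incident v)"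
          using e(1) edge_ends by (auto simp: vertex_sphere_def incident_def)
      qed
      show "finite (\<Union>v\<in>vertex_sphere x n. incident v)"
        using vs[OF Suc] card_incident by (auto simp: vertex_sphere_def)
    qed
  qed
  show "finite (vertex_sphere x n)"
    using vs[OF s] .
qed

text \<open>
  Sphere sums can be grouped by the vertices of level \<open>n\<close> in two ways: for \<open>k = n > 0\<close>, each vertex
  contributes its lowest edge, and for \<open>k = n + 1\<close>, it contributes its other edges.
\<close>

lemma sum_sphere_by_vertices:
  fixes g :: "'v set \<Rightarrow> 'b::comm_monoid_add"
  assumes x: "x \<in> edges G"
    and unique: "\<And>e. e \<in> edge_sphere x k \<Longrightarrow> \<exists>!v. v \<in> e \<and> vertex_level x v = n"
  shows "sum g (edge_sphere x k) = (\<Sum>v\<in>vertex_sphere x n. sum g (incident v \<inter> edge_sphere x k))"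
proof -
  have "edge_sphere x k = (\<Union>v\<in>vertex_sphere x n. incident v \<inter> edge_sphere x k)"
  proof
    show "edge_sphere x k \<subseteq> (\<Union>v\<in>vertex_sphere x n. incident v \<inter> edge_sphere x k)"
    proof
      fix e assume e: "e \<in> edge_sphere x k"
      then obtain v where v: "v \<in> e" "vertex_level x v = n"
        using unique by blast
      moreover have "e \<in> edges G"
        using e by (simp add: edge_sphere_def)
      moreover from this v have "v \<in> verts G"
        by (simp add: edge_vertex)
      ultimately show "e \<in> (\<Union>v\<in>vertex_sphere x n. incident v \<inter> edge_sphere x k)"
        using e by (auto simp: vertex_sphere_def incident_def)
    qed
  qed blast
  then have "sum g (edge_sphere x k) = sum g (\<Union>v\<in>vertex_sphere x n. incident v \<inter> edge_sphere x k)"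
    by (rule arg_cong)
  also have "\<dots> = (\<Sum>v\<in>vertex_sphere x n. sum g (incident v \<inter> edge_sphere x k))"
  proof (rule sum.UNION_disjoint)
    show "\<forall>i\<in>vertex_sphere x n. \<forall>j\<in>vertex_sphere x n.
        i \<noteq> j \<longrightarrow> (incident i \<inter> edge_sphere x k) \<inter> (incident j \<inter> edge_sphere x k) = {}"
    proof (intro ballI impI)
      fix i j assume "i \<in> vertex_sphere x n" "j \<in> vertex_sphere x n" "i \<noteq> j"
      moreover have "i = j" if "e \<in> edge_sphere x k" "i \<in> e" "j \<in> e"
          "vertex_level x i = n" "vertex_level x j = n" for e
        using unique[OF that(1)] that by blast
      ultimately show "(incident i \<inter> edge_sphere x k) \<inter> (incident j \<inter> edge_sphere x k) = {}"
        unfolding vertex_sphere_def incident_def by blast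
    qed
  qed (use finite_spheres[OF x] in auto)
  finally show ?thesis .
qed

text \<open>
  Passing through any vertex away from the root multiplies the amount of \<open>g\<close> by \<open>c\<close>; the edge \<open>d\<close> is
  recognised as the lowest one by the levels of the others.
\<close>

definition upward_ratio :: "'v set \<Rightarrow> 'b::comm_ring_1 \<Rightarrow> ('v set \<Rightarrow> 'b) \<Rightarrow> bool" where
  "upward_ratio x c g \<longleftrightarrow> (\<forall>v\<in>verts G. \<forall>d\<in>incident v.
     (\<forall>e\<in>incident v - {d}. level x e = Suc (level x d)) \<longrightarrow> sum g (incident v - {d}) = c * g d)"

text \<open>
  Each edge other than the root is the lowest edge of exactly one vertex, so sphere sums grow by
  the factor \<open>c\<close>.  The additional factor 2 comes from the root, which is the lowest edge at both of its
  ends.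
\<close>

lemma sum_sphere_geometric:
  fixes g :: "'v set \<Rightarrow> 'b::comm_ring_1"
  assumes x: "x \<in> edges G"
    and ratio: "upward_ratio x c g"
  shows "sum g (edge_sphere x (Suc n)) = 2 * c ^ Suc n * g x"
proof -
  have vertex: "sum g (incident v \<inter> edge_sphere x (Suc n)) = c * sum g (incident v \<inter> edge_sphere x n)"
    if "v \<in> vertex_sphere x n" for v n
  proof -
    have v: "v \<in> verts G" "vertex_level x v = n"
      using that by (auto simp: vertex_sphere_def)
    obtain d where d: "d \<in> incident v" "level x d = vertex_level x v"
      "\<And>e. e \<in> incident v - {d} \<Longrightarrow> level x e = Suc (vertex_level x v)"
      using edges_at_vertex[OF x v(1)] by blast
    have "incident v \<inter> edge_sphere x n = {d}"
      using d v(2) by (fastforce simp: edge_sphere_def incident_def)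
    moreover have "incident v \<inter> edge_sphere x (Suc n) = incident v - {d}"
      using d v(2) by (fastforce simp: edge_sphere_def incident_def)
    ultimately show ?thesis
      using ratio v(1) d by (simp add: upward_ratio_def)
  qed
  have ends: "\<exists>u v. e = {u, v} \<and> vertex_level x u = n \<and> vertex_level x v = Suc n"
    if "e \<in> edge_sphere x (Suc n)" for e n
    using edge_joins_levels[OF x, of e n] that unfolding edge_sphere_def by blast
  have up: "sum g (edge_sphere x (Suc n))
      = c * (\<Sum>v\<in>vertex_sphere x n. sum g (incident v \<inter> edge_sphere x n))" for n
  proof -
    have "sum g (edge_sphere x (Suc n)) = (\<Sum>v\<in>vertex_sphere x n. sum g (incident v \<inter> edge_sphere x (Suc n)))"
    proof (rule sum_sphere_by_vertices[OF x])
      fix e assume "e \<in> edge_sphere x (Suc n)"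
      then show "\<exists>!v. v \<in> e \<and> vertex_level x v = n"
        using ends by fastforce
    qed
    then show ?thesis
      by (simp add: vertex sum_distrib_left cong: sum.cong)
  qed
  show ?thesis
  proof (induction n)
    case 0
    have "vertex_sphere x 0 = x"
      using vertex_level_eq_0[OF x] edge_vertex[OF x] by (auto simp: vertex_sphere_def)
    moreover have "sum g (incident v \<inter> edge_sphere x 0) = g x" if "v \<in> x" for v
    proof -
      have "incident v \<inter> edge_sphere x 0 = {x}"
        using that x by (auto simp: edge_sphere_0 incident_def)
      then show ?thesis
        by simp
    qed
    moreover have "card x = 2"
      using x by (rule edgeE) simp
    ultimately show ?case
      using up[of 0] by (simp add: mult_ac cong: sum.cong)
  next
    case (Suc n)
    have "sum g (edge_sphere x (Suc n))
        = (\<Sum>v\<in>vertex_sphere x (Suc n). sum g (incident v \<inter> edge_sphere x (Suc n)))"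
    proof (rule sum_sphere_by_vertices[OF x])
      fix e assume "e \<in> edge_sphere x (Suc n)"
      then show "\<exists>!v. v \<in> e \<and> vertex_level x v = Suc n"
        using ends by fastforce
    qed
    then show ?case
      using up[of "Suc n"] Suc by (simp add: mult_ac)
  qed
qed

lemma sum_ball:
  fixes g :: "'v set \<Rightarrow> 'b::{real_normed_field}"
  assumes x: "x \<in> edges G"
    and ratio: "upward_ratio x (1 / 2) g"
  shows "finite (edge_ball x n)" "sum g (edge_ball x n) = (3 - 2 * (1 / 2) ^ n) * g x"
proof -
  have 0: "edge_ball x 0 = {x}"
    using edge_sphere_0[OF x] by (auto simp: edge_ball_def edge_sphere_def)
  have S: "edge_ball x (Suc n) = edge_ball x n \<union> edge_sphere x (Suc n)" "edge_ball x n \<inter> edge_sphere x (Suc n) = {}" for n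
    by (auto simp: edge_ball_def edge_sphere_def)
  show fin: "finite (edge_ball x n)" for n
    by (induction n) (simp_all add: 0 S finite_spheres x)
  show "sum g (edge_ball x n) = (3 - 2 * (1 / 2) ^ n) * g x"
  proof (induction n)
    case (Suc n)
    have "sum g (edge_ball x (Suc n)) = sum g (edge_ball x n) + sum g (edge_sphere x (Suc n))"
      unfolding S(1) by (intro sum.union_disjoint fin finite_spheres x S(2))
    also have "sum g (edge_sphere x (Suc n)) = 2 * (1 / 2) ^ Suc n * g x"
      by (rule sum_sphere_geometric[OF x ratio])
    finally show ?case
      unfolding Suc by (simp add: algebra_simps)
  qed (simp add: 0)
qed

lemma finite_subset_ball:
  assumes "finite A" "A \<subseteq> edges G"
  obtains n where "\<And>m. n \<le> m \<Longrightarrow> A \<subseteq> edge_ball x m"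
proof -
  have "level x e \<le> Max (level x ` A)" if "e \<in> A" for e
    using assms that by simp
  then show ?thesis
    using assms(2) by (intro that[of "Max (level x ` A)"]) (auto simp: edge_ball_def intro: order_trans)
qed

text \<open>
  \<open>1 + 2 (1/2 + 1/4 + \<dots>) = 3\<close>.  Both \<open>|K(x, \<cdot>)|\<^sup>2\<close> and \<open>K(x, \<cdot>) F\<close> for \<open>F\<close> in the eigenspace have
  upward ratio \<open>1/2\<close>, and the normalising constant \<open>1/3\<close> of the kernel is the inverse of this sum.
\<close>

lemma infsum_by_balls:
  fixes g :: "'v set \<Rightarrow> 'b::{real_normed_field}"
  assumes x: "x \<in> edges G" and summable: "g summable_on edges G"
    and ratio: "upward_ratio x (1 / 2) g"
  shows "infsum g (edges G) = 3 * g x"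
proof -
  have "filterlim (edge_ball x) (finite_subsets_at_top (edges G)) sequentially"
    unfolding filterlim_finite_subsets_at_top
  proof (intro allI impI)
    fix A assume "finite A \<and> A \<subseteq> edges G"
    then obtain n where "\<And>m. n \<le> m \<Longrightarrow> A \<subseteq> edge_ball x m"
      using finite_subset_ball[of A x] by blast
    then show "\<forall>\<^sub>F n in sequentially. finite (edge_ball x n) \<and> A \<subseteq> edge_ball x n \<and> edge_ball x n \<subseteq> edges G"
      unfolding eventually_sequentially
      using sum_ball(1)[OF x ratio] by (auto simp: edge_ball_def)
  qed
  moreover have "(sum g \<longlongrightarrow> infsum g (edges G)) (finite_subsets_at_top (edges G))"
    using has_sum_infsum[OF summable] by (simp add: has_sum_def)
  ultimately have "(\<lambda>n. sum g (edge_ball x n)) \<longlonglongrightarrow> infsum g (edges G)"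
    by (rule filterlim_compose[rotated])
  moreover have "(\<lambda>n. sum g (edge_ball x n)) \<longlonglongrightarrow> 3 * g x"
  proof -
    have "norm (1 / 2 :: 'b) = 1 / 2"
      by (simp only: norm_divide norm_one norm_numeral)
    then have lim: "(\<lambda>n. (1 / 2 :: 'b) ^ n) \<longlonglongrightarrow> 0"
      by (intro LIMSEQ_power_zero) simp
    have "(\<lambda>n. (3 - 2 * (1 / 2) ^ n) * g x) \<longlonglongrightarrow> (3 - 2 * 0) * g x"
      by (intro tendsto_mult tendsto_diff tendsto_const lim)
    then show ?thesis
      by (simp add: sum_ball(2)[OF x ratio])
  qed
  ultimately show ?thesis
    by (rule LIMSEQ_unique)
qed

lemma card_upper_edges:
  assumes "v \<in> verts G" "d \<in> incident v"
  shows "card (incident v - {d}) = 2"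
  using card_incident[OF assms(1)] assms(2) by simp

text \<open>
  Counting edges is the case of ratio 2: every sphere of positive radius \<open>n\<close> has \<open>2 \<cdot> 2\<^sup>n\<close> elements.
\<close>

lemma infinite_edges: "infinite (edges G)"
proof
  assume fin: "finite (edges G)"
  obtain x where x: "x \<in> edges G"
    using connected_edge_graph by (auto simp: connected_graph_def)
  obtain n where n: "\<And>m. n \<le> m \<Longrightarrow> edges G \<subseteq> edge_ball x m"
    using finite_subset_ball[OF fin subset_refl] by blast
  have "edge_sphere x (Suc n) = {}"
    using n[of n] by (force simp: edge_sphere_def edge_ball_def)
  moreover have "(\<Sum>e\<in>edge_sphere x (Suc n). 1 :: int) = 2 * 2 ^ Suc n * 1"
    by (rule sum_sphere_geometric[OF x])
      (simp add: upward_ratio_def card_upper_edges del: card_Diff_insert)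
  ultimately show False
    by simp
qed

lemma infinite_verts: "infinite (verts G)"
proof
  assume "finite (verts G)"
  moreover have "edges G \<subseteq> Pow (verts G)"
    using edge_vertex by blast
  ultimately show False
    using infinite_edges by (meson finite_Pow_iff finite_subset)
qed

section \<open>The eigenspace and its reproducing kernel\<close>

text \<open>
  The four neighbours of an edge are the other edges at its two ends, so
  \<open>F\<close> summed over them is the sum of the two vertex sums minus \<open>2 F\<close>.
\<close>

lemma laplacian_by_vertex_sums:
  assumes e: "{u, v} \<in> edges G"
  shows "laplacian (edge_graph G) F {u, v}
      = sum F (incident u) + sum F (incident v) - 6 * F {u, v}"
proof -
  note ends = edge_ends[OF e]
  have inc: "{u, v} \<in> incident u" "{u, v} \<in> incident v"
    using e by (auto intro: incidentI)
  have half: "(\<Sum>f\<in>incident w - {{u, v}}. F f - F {u, v}) = sum F (incident w) - 3 * F {u, v}"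
    if w: "w \<in> verts G" "{u, v} \<in> incident w" for w
  proof -
    have "(\<Sum>f\<in>incident w - {{u, v}}. F f - F {u, v}) = (\<Sum>f\<in>incident w. F f - F {u, v})"
      using sum.remove[OF card_incident(1)[OF w(1)] w(2), of "\<lambda>f. F f - F {u, v}"] by simp
    also have "\<dots> = sum F (incident w) - 3 * F {u, v}"
      by (simp add: sum_subtractf card_incident w)
    finally show ?thesis .
  qed
  have "neighbors (edge_graph G) {u, v} = (incident u - {{u, v}}) \<union> (incident v - {{u, v}})"
    using e by (auto simp: neighbors_def adjacent_edges_iff incident_def)
  moreover have "(incident u - {{u, v}}) \<inter> (incident v - {{u, v}}) = {}"
  proof -
    have "f = {u, v}" if "f \<in> incident u" "f \<in> incident v" for f
      using that(1) incidentD(2)[OF that(2)] ends(3) by (elim incident_edgeE) auto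
    then show ?thesis
      by blast
  qed
  ultimately have "laplacian (edge_graph G) F {u, v}
      = (\<Sum>f\<in>incident u - {{u, v}}. F f - F {u, v}) + (\<Sum>f\<in>incident v - {{u, v}}. F f - F {u, v})"
    unfolding laplacian_def using card_incident ends by (simp add: sum.union_disjoint)
  then show ?thesis
    using half ends inc by simp
qed

text \<open>
  A square-summable function exceeds a given positive size on only finitely many edges.  These touch finitely
  many vertices, so there is a vertex all of whose edges carry values too small for the common
  modulus of the vertex sums to be positive.
\<close>

lemma summable_vertex_sums_vanish:
  assumes F: "F \<in> l2 (edges G)"
    and const: "\<And>u v. u \<in> verts G \<Longrightarrow> v \<in> verts G \<Longrightarrow>
      cmod (sum F (incident u)) = cmod (sum F (incident v))"
    and w: "w \<in> verts G"
  shows "sum F (incident w) = 0"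
proof (rule ccontr)
  define c where "c = cmod (sum F (incident w))"
  assume "sum F (incident w) \<noteq> 0"
  then have c: "c > 0"
    by (simp add: c_def)
  define B where "B = {e \<in> edges G. (c / 3)\<^sup>2 \<le> (cmod (F e))\<^sup>2}"
  have "finite B"
  proof (rule ccontr)
    assume "infinite B"
    define S where "S = l2_normsq (edges G) F"
    obtain n :: nat where n: "S / (c / 3)\<^sup>2 < of_nat n"
      using reals_Archimedean2 by blast
    obtain A where A: "finite A" "card A = n" "A \<subseteq> B"
      using infinite_arbitrarily_large[OF \<open>infinite B\<close>] by blast
    have "of_nat n * (c / 3)\<^sup>2 \<le> (\<Sum>e\<in>A. (cmod (F e))\<^sup>2)"
      using A sum_mono[of A "\<lambda>_. (c / 3)\<^sup>2" "\<lambda>e. (cmod (F e))\<^sup>2"] by (auto simp: B_def)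
    also have "\<dots> \<le> S"
      unfolding S_def
      by (rule finite_sum_le_infsum[OF l2_square_summable[OF F]]) (use A in \<open>auto simp: B_def\<close>)
    finally show False
      using n c by (simp add: divide_less_eq)
  qed
  moreover have "finite e" if "e \<in> B" for e
    using that finite_edge by (simp add: B_def)
  ultimately have "finite (\<Union>B)"
    by blast
  then obtain v where v: "v \<in> verts G" "v \<notin> \<Union>B"
    using infinite_verts by (meson finite_subset subsetI)
  have small: "cmod (F e) < c / 3" if "e \<in> incident v" for e
  proof (rule ccontr)
    assume "\<not> cmod (F e) < c / 3"
    then have "e \<in> B"
      using that c by (auto simp: B_def incident_def intro: power_mono)
    then show False
      using v that by (auto simp: incident_def)
  qed
  have "c = cmod (sum F (incident v))"
    unfolding c_def by (rule const[OF w v(1)])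
  also have "\<dots> \<le> (\<Sum>e\<in>incident v. cmod (F e))"
    by (rule norm_sum)
  also have "\<dots> < (\<Sum>e\<in>incident v. c / 3)"
    using card_incident[OF v(1)] small by (intro sum_strict_mono) auto
  also have "\<dots> = c"
    by (simp add: card_incident v)
  finally show False
    by simp
qed

text \<open>
  The eigenvalue equation at an edge says that the vertex sums at its two ends add up to zero.
  Vertex sums thus only change sign along edges, and square-summability forces them to
  vanish.
\<close>

lemma eigenspace_eq_vanishing_vertex_sums:
  "eigenspace (edge_graph G) 6 = {F \<in> l2 (edges G). \<forall>v\<in>verts G. sum F (incident v) = 0}"
proof (intro equalityI subsetI CollectI conjI)
  fix F assume F: "F \<in> eigenspace (edge_graph G) 6"
  then show l2: "F \<in> l2 (edges G)"
    by (simp add: eigenspace_def)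
  have step: "sum F (incident v) = - sum F (incident u)" if "{u, v} \<in> edges G" for u v
  proof -
    have "- laplacian (edge_graph G) F {u, v} = 6 * F {u, v}"
      using F that by (simp add: eigenspace_def)
    then have "- sum F (incident u) = sum F (incident v)"
      unfolding laplacian_by_vertex_sums[OF that] by simp
    then show ?thesis
      by (rule sym)
  qed
  have walk: "cmod (sum F (incident v)) = cmod (sum F (incident u))" if "walk_betw G u n v" for u v n
    using that
  proof (induction n arbitrary: v)
    case (Suc n)
    then show ?case
      using step by (force simp: walk_betw_Suc)
  qed (simp add: walk_betw_0)
  have "cmod (sum F (incident u)) = cmod (sum F (incident v))" if "u \<in> verts G" "v \<in> verts G" for u v
    using connected that walk unfolding connected_graph_def by metis
  then show "\<forall>v\<in>verts G. sum F (incident v) = 0"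
    using summable_vertex_sums_vanish[OF l2] by blast
next
  fix F assume "F \<in> {F \<in> l2 (edges G). \<forall>v\<in>verts G. sum F (incident v) = 0}"
  then have F: "F \<in> l2 (edges G)" "\<And>v. v \<in> verts G \<Longrightarrow> sum F (incident v) = 0"
    by auto
  have "- laplacian (edge_graph G) F e = 6 * F e" if e: "e \<in> edges G" for e
  proof -
    obtain u v where "e = {u, v}" "u \<in> verts G" "v \<in> verts G"
      using edgeE[OF e] by blast
    then show ?thesis
      using laplacian_by_vertex_sums[of u v F] e F(2) by simp
  qed
  then show "F \<in> eigenspace (edge_graph G) 6"
    using F(1) by (simp add: eigenspace_def)
qed

text \<open>
  The row of the kernel at \<open>x\<close>, cut off outside the edge set so that it is an element of \<open>l2\<close>.
\<close>

definition kernel_at :: "'v set \<Rightarrow> 'v set \<Rightarrow> complex" where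
  "kernel_at x y = (if y \<in> edges G then of_real (P6_kernel (edge_graph G) x y) else 0)"

lemma kernel_upper:
  assumes "e \<in> edges G" "d \<in> edges G" "level x e = Suc (level x d)"
  shows "kernel_at x e = - (1 / 2) * kernel_at x d"
  using assms by (simp add: kernel_at_def P6_kernel_def)

text \<open>
  At each vertex the two upper edges carry \<open>1/4\<close> of the squared value of the lower one, so the upward ratio is
  \<open>2 \<cdot> 1/4 = 1/2\<close>.
\<close>

lemma kernel_l2:
  assumes x: "x \<in> edges G"
  shows "kernel_at x \<in> l2 (edges G)"
proof -
  let ?g = "\<lambda>e. (cmod (kernel_at x e))\<^sup>2"
  have ratio: "upward_ratio x (1 / 2) ?g"
    unfolding upward_ratio_def
  proof (intro ballI impI)
    fix v d assume v: "v \<in> verts G" and d: "d \<in> incident v"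
      and up: "\<forall>e\<in>incident v - {d}. level x e = Suc (level x d)"
    have "?g e = 1 / 4 * ?g d" if "e \<in> incident v - {d}" for e
      using kernel_upper[of e d x] that d up
      by (simp add: incident_def norm_mult power_mult_distrib norm_divide power_divide)
    then have "sum ?g (incident v - {d}) = (\<Sum>e\<in>incident v - {d}. 1 / 4 * ?g d)"
      by (rule sum.cong[OF refl])
    then show "sum ?g (incident v - {d}) = 1 / 2 * ?g d"
      using card_upper_edges[OF v d] by simp
  qed
  have "?g summable_on edges G"
  proof (rule nonneg_bounded_partial_sums_imp_summable_on[where C = "3 * ?g x"])
    show "\<forall>\<^sub>F A in finite_subsets_at_top (edges G). sum ?g A \<le> 3 * ?g x"
    proof (rule eventually_finite_subsets_at_top_weakI)
      fix A assume "finite A" "A \<subseteq> edges G"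
      then obtain n where n: "\<And>m. n \<le> m \<Longrightarrow> A \<subseteq> edge_ball x m"
        using finite_subset_ball[of A x] by blast
      have "sum ?g A \<le> sum ?g (edge_ball x n)"
        by (intro sum_mono2 sum_ball(1)[OF x ratio] n) auto
      also have "\<dots> = (3 - 2 * (1 / 2) ^ n) * ?g x"
        by (rule sum_ball(2)[OF x ratio])
      also have "\<dots> \<le> 3 * ?g x"
        by (intro mult_right_mono) auto
      finally show "sum ?g A \<le> 3 * ?g x" .
    qed
  qed simp
  then show ?thesis
    by (simp add: l2_def kernel_at_def)
qed

text \<open>
  If the lowest edge has the value \<open>t\<close>, then the other two have \<open>-t/2\<close> each.
\<close>

lemma kernel_vertex_sum:
  assumes x: "x \<in> edges G" and v: "v \<in> verts G"
  shows "sum (kernel_at x) (incident v) = 0"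
proof -
  obtain d where d: "d \<in> incident v" "level x d = vertex_level x v"
    "\<And>e. e \<in> incident v - {d} \<Longrightarrow> level x e = Suc (vertex_level x v)"
    using edges_at_vertex[OF x v] by blast
  have "kernel_at x e = - (1 / 2) * kernel_at x d" if "e \<in> incident v - {d}" for e
    using that d by (intro kernel_upper) (auto simp: incident_def)
  then have "sum (kernel_at x) (incident v - {d}) = (\<Sum>e\<in>incident v - {d}. - (1 / 2) * kernel_at x d)"
    by (rule sum.cong[OF refl])
  also have "\<dots> = - kernel_at x d"
    using card_upper_edges[OF v d(1)] by simp
  finally show ?thesis
    using sum.remove[OF card_incident(1)[OF v] d(1), of "kernel_at x"] by simp
qed

lemma kernel_in_eigenspace: "x \<in> edges G \<Longrightarrow> kernel_at x \<in> eigenspace (edge_graph G) 6"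
  by (simp add: eigenspace_eq_vanishing_vertex_sums kernel_l2 kernel_vertex_sum)

text \<open>
  Vanishing vertex sums make the values of \<open>F\<close> on the two upper edges add up to minus the value on
  the lower edge, while the kernel changes by the factor \<open>-1/2\<close>.  The product therefore has upward
  ratio \<open>1/2\<close>, and its sum is three times its value \<open>F x / 3\<close> at the root.
\<close>

lemma kernel_reproducing:
  assumes F: "F \<in> eigenspace (edge_graph G) 6" and x: "x \<in> edges G"
  shows "l2_inner (edges G) F (kernel_at x) = F x"
proof -
  have l2: "F \<in> l2 (edges G)" and zero: "\<And>v. v \<in> verts G \<Longrightarrow> sum F (incident v) = 0"
    using F by (simp_all add: eigenspace_eq_vanishing_vertex_sums)
  let ?g = "\<lambda>e. F e * cnj (kernel_at x e)"
  have ratio: "upward_ratio x (1 / 2) ?g"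
    unfolding upward_ratio_def
  proof (intro ballI impI)
    fix v d assume v: "v \<in> verts G" and d: "d \<in> incident v"
      and up: "\<forall>e\<in>incident v - {d}. level x e = Suc (level x d)"
    have "?g e = F e * (- (1 / 2) * cnj (kernel_at x d))" if "e \<in> incident v - {d}" for e
    proof -
      have "kernel_at x e = - (1 / 2) * kernel_at x d"
        using that d up incidentD(1) by (intro kernel_upper) blast+
      then show ?thesis
        by simp
    qed
    then have "sum ?g (incident v - {d}) = (\<Sum>e\<in>incident v - {d}. F e) * (- (1 / 2) * cnj (kernel_at x d))"
      unfolding sum_distrib_right by (rule sum.cong[OF refl])
    also have "(\<Sum>e\<in>incident v - {d}. F e) = - F d"
      using sum.remove[OF card_incident(1)[OF v] d, of F] zero[OF v]
      by (simp add: eq_neg_iff_add_eq_0 add.commute)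
    finally show "sum ?g (incident v - {d}) = 1 / 2 * ?g d"
      by simp
  qed
  have "l2_inner (edges G) F (kernel_at x) = 3 * ?g x"
    unfolding l2_inner_def
    by (rule infsum_by_balls[OF x l2_product_summable[OF l2 kernel_l2[OF x]] ratio])
  also have "\<dots> = F x"
    using x by (simp add: kernel_at_def P6_kernel_def)
  finally show ?thesis .
qed

lemma P6_summand: "y \<in> edges G \<Longrightarrow>
    complex_of_real (P6_kernel (edge_graph G) x y) * F y = F y * cnj (kernel_at x y)"
  by (simp add: kernel_at_def)

lemma P6_eq_inner:
  assumes "x \<in> edges G"
  shows "P6 (edge_graph G) F x = l2_inner (edges G) F (kernel_at x)"
proof -
  have "P6 (edge_graph G) F x
      = (\<Sum>\<^sub>\<infinity>y\<in>edges G. complex_of_real (P6_kernel (edge_graph G) x y) * F y)"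
    using assms by (simp add: P6_def)
  also have "\<dots> = l2_inner (edges G) F (kernel_at x)"
    unfolding l2_inner_def by (rule infsum_cong) (rule P6_summand)
  finally show ?thesis .
qed

text \<open>
  By symmetry of the kernel, summing \<open>K(e, y)\<close> over the edges \<open>e\<close> at \<open>v\<close> amounts to a vertex sum
  of the kernel function rooted at \<open>y\<close>.
\<close>

lemma P6_vertex_sum:
  assumes F: "F \<in> l2 (edges G)" and v: "v \<in> verts G"
  shows "sum (P6 (edge_graph G) F) (incident v) = 0"
proof -
  have "sum (P6 (edge_graph G) F) (incident v) = (\<Sum>e\<in>incident v. cnj 1 * l2_inner (edges G) F (kernel_at e))"
    by (intro sum.cong) (auto simp: P6_eq_inner dest: incidentD)
  also have "\<dots> = l2_inner (edges G) F (\<lambda>y. \<Sum>e\<in>incident v. 1 * kernel_at e y)"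
    by (rule l2_inner_sum_right[symmetric]) (auto intro: F kernel_l2 dest: incidentD)
  also have "(\<lambda>y. \<Sum>e\<in>incident v. 1 * kernel_at e y) = (\<lambda>y. 0)"
  proof
    fix y
    show "(\<Sum>e\<in>incident v. 1 * kernel_at e y) = 0"
    proof (cases "y \<in> edges G")
      case True
      then have "(\<Sum>e\<in>incident v. 1 * kernel_at e y) = sum (kernel_at y) (incident v)"
        by (intro sum.cong)
          (auto simp: kernel_at_def P6_kernel_def gdist_sym[of _ y] dest: incidentD)
      then show ?thesis
        using kernel_vertex_sum[OF True v] by simp
    qed (simp add: kernel_at_def)
  qed
  finally show ?thesis
    by (simp add: l2_inner_def)
qed

lemma P6_orthogonal_projection:
  "orthogonal_projection_onto (edges G) (eigenspace (edge_graph G) 6) (P6 (edge_graph G))"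
proof (rule reproducing_kernel_orthogonal_projection[where k = kernel_at])
  show "eigenspace (edge_graph G) 6 \<subseteq> l2 (edges G)"
    by (auto simp: eigenspace_eq_vanishing_vertex_sums)
  show "P6 (edge_graph G) F \<in> eigenspace (edge_graph G) 6"
    if "F \<in> l2 (edges G)" "P6 (edge_graph G) F \<in> l2 (edges G)" for F
    using that P6_vertex_sum by (simp add: eigenspace_eq_vanishing_vertex_sums)
  show "P6 (edge_graph G) F x = 0" if "x \<notin> edges G" for F x
    using that by (simp add: P6_def)
qed (simp_all add: kernel_in_eigenspace kernel_reproducing P6_eq_inner)

lemma P6_summable:
  assumes "F \<in> l2 (edges G)" "x \<in> edges G"
  shows "(\<lambda>y. complex_of_real (P6_kernel (edge_graph G) x y) * F y) summable_on edges G"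
  using l2_product_summable[OF assms(1) kernel_l2[OF assms(2)]]
  by (simp add: P6_summand cong: summable_on_cong)

end

theorem theorem4p5:
  fixes \<Gamma> :: "'v sgraph" and \<Gamma>0 :: "'v set sgraph"
  assumes tree: "tree_graph \<Gamma>" and regular: "regular_graph 3 \<Gamma>"
    and edge_graph: "\<Gamma>0 = edge_graph \<Gamma>"
  shows "(\<forall>F\<in>l2 (verts \<Gamma>0). \<forall>x\<in>verts \<Gamma>0.
            (\<lambda>y. complex_of_real (P6_kernel \<Gamma>0 x y) * F y) summable_on verts \<Gamma>0) \<and>
         orthogonal_projection_onto (verts \<Gamma>0) (eigenspace \<Gamma>0 6) (P6 \<Gamma>0)"
proof -
  interpret cubic_tree \<Gamma>
    using tree regular by unfold_locales
  show ?thesis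
    unfolding edge_graph verts_edge_graph
    using P6_summable P6_orthogonal_projection by blast
qed

end
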